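(* Let $a,b,q$ be indeterminates and let $(Q_n(x))_{n\ge0}$ be the Al-Salam–Chihara polynomials, defined by $Q_{-1}(x)=0$, $Q_0(x)=1$ and \[ 2xQ_n(x)=Q_{n+1}(x)+(a+b)q^nQ_n(x)+(1-q^n)(1-abq^{n-1})Q_{n-1}(x)\quad(n\ge0). \] Let $\mathcal L$ be the linear functional on $\mathbb Q(a,b,q)[x]$ with $\mathcal L(1)=1$ and $\mathcal L(Q_n)=0$ for all $n\ge1$, and let $\mu_N=\mathcal L(x^N)$. Then \[ \mu_N=\frac{1}{2^N}\sum_{\substack{0\le n\le N\\ n\equiv N\ (\mathrm{mod}\ 2)}}\left(\sum_{j=0}^{(N-n)/2}(-1)^jq^{\binom{j+1}{2}}\begin{bmatrix} n+j\\ j\end{bmatrix}_q\left(\binom{N}{\frac{N-n}{2}-j}-\binom{N}{\frac{N-n}{2}-j-1}\right)\right)\left(\sum_{k=0}^{n}\begin{bmatrix} n\\ k\end{bmatrix}_q a^kb^{n-k}\right). \]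
   Context: $\begin{bmatrix} n\\ k\end{bmatrix}_q$ denotes the Gaussian $q$-binomial coefficient; binomial coefficients with negative lower index are $0$. *)

theory Defs
  imports
    "HOL-Computational_Algebra.Computational_Algebra"
begin

text \<open>
  \<open>\<rat>(a,b,q)\<close> is the fraction field of \<open>\<rat>[a][b][q]\<close>; \<open>a\<close> is the innermost polynomial variable and
  \<open>q\<close> the outermost one.
\<close>

type_synonym ratfun_abq = "rat poly poly poly fract"

definition indet_a :: ratfun_abq where
  "indet_a = to_fract [:[:[:0, 1:]:]:]"

definition indet_b :: ratfun_abq where
  "indet_b = to_fract [:[:0, 1:]:]"

definition indet_q :: ratfun_abq where
  "indet_q = to_fract [:0, 1:]"

text \<open>Meaningful as a quotient only if \<open>q\<close> is not a root of unity, e.g. if it is an indeterminate.\<close>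

definition gauss_binomial :: "'a::field \<Rightarrow> nat \<Rightarrow> nat \<Rightarrow> 'a" where
  "gauss_binomial q n k =
     (if k \<le> n
      then (\<Prod>i=1..n. 1 - q ^ i) / ((\<Prod>i=1..k. 1 - q ^ i) * (\<Prod>i=1..n - k. 1 - q ^ i))
      else 0)"

definition int_binomial :: "nat \<Rightarrow> int \<Rightarrow> nat" where
  "int_binomial n k = (if k < 0 then 0 else n choose nat k)"

text \<open>
  The polynomials are indexed by integers so that the initial value \<open>Q\<^sub>-\<^sub>1 = 0\<close> can be expressed. The
  recurrence determines them only from index \<open>-1\<close> on; below that they are set to \<open>0\<close>.
\<close>

function alsalam_chihara :: "'a::field \<Rightarrow> 'a \<Rightarrow> 'a \<Rightarrow> int \<Rightarrow> 'a poly" where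
  "alsalam_chihara a b q n =
     (if n < 0 then 0
      else if n = 0 then 1
      else [:0, 2:] * alsalam_chihara a b q (n - 1)
           - smult ((a + b) * q powi (n - 1)) (alsalam_chihara a b q (n - 1))
           - smult ((1 - q powi (n - 1)) * (1 - a * b * q powi (n - 2)))
               (alsalam_chihara a b q (n - 2)))"
  by pat_completeness auto
termination
  by (relation "Wellfounded.measure (\<lambda>(a, b, q, n). nat (n + 1))") auto

declare alsalam_chihara.simps [simp del]

lemma alsalam_chihara_minus_1: "alsalam_chihara a b q (-1) = 0"
  by (simp add: alsalam_chihara.simps)

lemma alsalam_chihara_0: "alsalam_chihara a b q 0 = 1"
  by (simp add: alsalam_chihara.simps)

lemma alsalam_chihara_recurrence:
  assumes "n \<ge> 0"
  shows "[:0, 2:] * alsalam_chihara a b q n =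
           alsalam_chihara a b q (n + 1)
           + smult ((a + b) * q powi n) (alsalam_chihara a b q n)
           + smult ((1 - q powi n) * (1 - a * b * q powi (n - 1))) (alsalam_chihara a b q (n - 1))"
  using assms by (subst (2) alsalam_chihara.simps) (simp add: algebra_simps)

end

theory Submission
  imports Defs
begin

text \<open>
  Let \<open>H\<^sub>n\<close> be the continuous \<open>q\<close>-Hermite polynomials, i.e. the case \<open>a = b = 0\<close> of \<open>Q\<^sub>n\<close>, and let
  \<open>h\<^sub>n\<close> be the homogeneous Rogers-Szego polynomials in \<open>a, b\<close>, i.e. the last factor of the formula.
  Comparing three-term recurrences gives \<open>H\<^sub>m = \<Sum>\<^sub>k [m, k] h\<^sub>m\<^sub>-\<^sub>k Q\<^sub>k\<close>, hence \<open>\<L>(H\<^sub>m) = h\<^sub>m\<close>. In the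
  same way, the first factor of the formula is the coefficient of \<open>H\<^sub>n\<close> in \<open>(2x)\<^sup>N\<close>.
\<close>

section \<open>Gaussian binomial coefficients\<close>

lemma gauss_binomial_eq_0: "n < k \<Longrightarrow> gauss_binomial q n k = 0"
  by (simp add: gauss_binomial_def)

lemma gauss_binomial_add:
  "gauss_binomial q (k + m) k =
     (\<Prod>i=1..k + m. 1 - q ^ i) / ((\<Prod>i=1..k. 1 - q ^ i) * (\<Prod>i=1..m. 1 - q ^ i))"
  by (simp add: gauss_binomial_def)

text \<open>This gives the quotient in \<open>gauss_binomial\<close> a nonzero denominator. The
  identities up to the moment formula hold over any field with such a \<open>q\<close>;
  indeterminates enter only at the end.\<close>

locale non_root_of_unity =
  fixes q :: "'a::field"
  assumes power_neq_1: "n > 0 \<Longrightarrow> q ^ n \<noteq> 1"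
begin

lemma q_factorial_nonzero: "(\<Prod>i=1..n. 1 - q ^ i) \<noteq> 0"
  using power_neq_1 by auto

lemma gauss_binomial_0: "gauss_binomial q n 0 = 1"
  and gauss_binomial_self: "gauss_binomial q n n = 1"
  using q_factorial_nonzero[of n] by (simp_all add: gauss_binomial_def)

lemma gauss_binomial_absorb:
  "(1 - q ^ Suc k) * gauss_binomial q (Suc n) (Suc k) = (1 - q ^ Suc n) * gauss_binomial q n k"
proof (cases "k \<le> n")
  case True
  then obtain m where n: "n = k + m"
    using le_Suc_ex by blast
  show ?thesis
    using gauss_binomial_add[of q "Suc k" m] power_neq_1[of "Suc k"]
    by (simp add: n gauss_binomial_add mult_ac)
qed (simp add: gauss_binomial_eq_0)

lemma gauss_binomial_absorb_comp:
  "(1 - q ^ Suc m) * gauss_binomial q (Suc (k + m)) k = (1 - q ^ Suc (k + m)) * gauss_binomial q (k + m) k"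
  using gauss_binomial_add[of q k "Suc m"] power_neq_1[of "Suc m"]
  by (simp add: gauss_binomial_add mult_ac)

lemma gauss_binomial_Suc_right:
  "(1 - q ^ Suc k) * gauss_binomial q n (Suc k) = (1 - q ^ (n - k)) * gauss_binomial q n k"
proof (cases "k < n")
  case True
  then obtain m where n: "n = Suc (k + m)"
    using less_imp_Suc_add by blast
  show ?thesis
    using gauss_binomial_absorb[of k "k + m"] gauss_binomial_absorb_comp[of m k]
    by (simp add: n)
qed (simp add: gauss_binomial_eq_0)

text \<open>Multiplied by the nonzero factor 1 - q^(k+1), both sides become multiples of [n, k], and
  (1 - q^(k+1)) + q^(k+1) (1 - q^(n-k)) = 1 - q^(n+1).\<close>

lemma gauss_binomial_Suc_Suc:
  "gauss_binomial q (Suc n) (Suc k) = gauss_binomial q n k + q ^ Suc k * gauss_binomial q n (Suc k)"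
proof (cases "k \<le> n")
  case True
  then obtain m where n: "n = k + m"
    using le_Suc_ex by blast
  have "(1 - q ^ Suc k) * (gauss_binomial q n k + q ^ Suc k * gauss_binomial q n (Suc k)) =
      (1 - q ^ Suc k) * gauss_binomial q n k
      + q ^ Suc k * ((1 - q ^ Suc k) * gauss_binomial q n (Suc k))"
    by (simp only: distrib_left mult.left_commute)
  also have "\<dots> = (1 - q ^ Suc n) * gauss_binomial q n k"
    unfolding gauss_binomial_Suc_right by (simp add: n algebra_simps power_add)
  finally have "(1 - q ^ Suc k) * gauss_binomial q (Suc n) (Suc k) =
      (1 - q ^ Suc k) * (gauss_binomial q n k + q ^ Suc k * gauss_binomial q n (Suc k))"
    by (simp only: gauss_binomial_absorb)
  then show ?thesis
    using power_neq_1[of "Suc k"] by auto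
qed (simp add: gauss_binomial_eq_0)

lemma gauss_binomial_Suc_Suc':
  "gauss_binomial q (Suc n) (Suc k) =
     gauss_binomial q n (Suc k) + q ^ (n - k) * gauss_binomial q n k"
  using gauss_binomial_Suc_Suc[of n k] gauss_binomial_Suc_right[of k n]
  by (simp add: algebra_simps)

section \<open>Rogers-Szego polynomials\<close>

definition rogers_szego :: "'a \<Rightarrow> 'a \<Rightarrow> nat \<Rightarrow> 'a" where
  "rogers_szego a b n = (\<Sum>k\<le>n. gauss_binomial q n k * a ^ k * b ^ (n - k))"

lemma rogers_szego_0: "rogers_szego a b 0 = 1"
  and rogers_szego_1: "rogers_szego a b (Suc 0) = a + b"
  by (simp_all add: rogers_szego_def gauss_binomial_0 gauss_binomial_self)

lemma rogers_szego_recurrence: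
  "rogers_szego a b (Suc (Suc n)) =
     (a + b) * rogers_szego a b (Suc n) - a * b * (1 - q ^ Suc n) * rogers_szego a b n"
proof -
  define f where "f n k = gauss_binomial q n k * a ^ k * b ^ (n - k)" for n k
  have h: "rogers_szego a b n = (\<Sum>k\<le>n. f n k)" for n
    by (simp add: rogers_szego_def f_def)
  have f0: "f n 0 = b ^ n" for n
    by (simp add: f_def gauss_binomial_0)
  have f_top: "f n (Suc n) = 0" for n
    by (simp add: f_def gauss_binomial_eq_0)
  have step: "f (Suc (Suc n)) (Suc k) =
      a * f (Suc n) k + b * f (Suc n) (Suc k) - a * b * (1 - q ^ Suc n) * f n k"
    if "k \<le> Suc n" for k
  \<comment> \<open>At k = n + 1 the truncated \<open>n - k\<close> would break \<open>b1\<close>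
    below; there only the top power of a survives.\<close>
  proof (cases "k = Suc n")
    case True
    then show ?thesis
      by (simp add: f_def gauss_binomial_self gauss_binomial_eq_0)
  next
    case False
    with that have "k \<le> n"
      by simp
    then have b1: "b * b ^ (n - k) = b ^ (Suc n - k)"
      by (simp add: Suc_diff_le)
    have "f (Suc (Suc n)) (Suc k) = (gauss_binomial q (Suc n) k
        + q ^ Suc k * gauss_binomial q (Suc n) (Suc k)) * a ^ Suc k * b ^ (Suc n - k)"
      by (simp add: f_def gauss_binomial_Suc_Suc)
    \<comment> \<open>Splitting q^(k+1) = 1 - (1 - q^(k+1)) prepares the second part for absorption,
      which lowers n + 1 to n.\<close>
    also have "\<dots> = a * f (Suc n) k + gauss_binomial q (Suc n) (Suc k) * a ^ Suc k * (b * b ^ (n - k))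
        - (1 - q ^ Suc k) * gauss_binomial q (Suc n) (Suc k) * a ^ Suc k * (b * b ^ (n - k))"
      unfolding b1 by (simp add: f_def algebra_simps)
    also have "\<dots> = a * f (Suc n) k + b * f (Suc n) (Suc k) - a * b * (1 - q ^ Suc n) * f n k"
      unfolding gauss_binomial_absorb by (simp add: f_def mult_ac)
    finally show ?thesis .
  qed
  have "rogers_szego a b (Suc (Suc n)) = b ^ Suc (Suc n) + (\<Sum>k\<le>Suc n. f (Suc (Suc n)) (Suc k))"
    unfolding h by (subst sum.atMost_Suc_shift) (simp only: f0)
  also have "(\<Sum>k\<le>Suc n. f (Suc (Suc n)) (Suc k)) =
      (\<Sum>k\<le>Suc n. a * f (Suc n) k + b * f (Suc n) (Suc k) - a * b * (1 - q ^ Suc n) * f n k)"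
    by (rule sum.cong) (simp_all only: atMost_iff step)
  also have "\<dots> = a * (\<Sum>k\<le>Suc n. f (Suc n) k)
      + b * (\<Sum>k\<le>Suc n. f (Suc n) (Suc k)) - a * b * (1 - q ^ Suc n) * (\<Sum>k\<le>Suc n. f n k)"
    by (simp only: sum_distrib_left sum.distrib sum_subtractf)
  also have "(\<Sum>k\<le>Suc n. f n k) = rogers_szego a b n"
    by (simp add: h f_top)
  also have "(\<Sum>k\<le>Suc n. f (Suc n) (Suc k)) = rogers_szego a b (Suc n) - b ^ Suc n"
    using sum.atMost_Suc_shift[of "f (Suc n)" "Suc n"] by (simp add: h f0 f_top)
  finally show ?thesis
    by (simp add: h algebra_simps)
qed


section \<open>Three-term recurrences\<close>

lemma (in -) smult_sum_right: "smult c (\<Sum>i\<in>A. f i) = (\<Sum>i\<in>A. smult c (f i))"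
  by (induction A rule: infinite_finite_induct) (simp_all add: smult_add_right)

text \<open>The case distinction stands for \<open>e\<^sub>-\<^sub>1 = 0\<close>.\<close>

lemma (in -) three_term_recurrence_sum:
  fixes P :: "nat \<Rightarrow> 'a::comm_ring_1 poly"
  assumes rec: "\<And>n. t * P n = P (Suc n) + smult (\<alpha> n) (P n) + smult (\<beta> n) (P (n - 1))"
    and "\<beta> 0 = 0" and e: "\<And>k. k > m \<Longrightarrow> e k = 0"
  shows "t * (\<Sum>k\<le>m. smult (e k) (P k)) =
    (\<Sum>k\<le>Suc m. smult ((case k of 0 \<Rightarrow> 0 | Suc i \<Rightarrow> e i) + \<alpha> k * e k + \<beta> (Suc k) * e (Suc k)) (P k))"
proof -
  have "t * (\<Sum>k\<le>m. smult (e k) (P k)) =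
      (\<Sum>k\<le>m. smult (e k) (P (Suc k))) + (\<Sum>k\<le>m. smult (\<alpha> k * e k) (P k))
      + (\<Sum>k\<le>m. smult (\<beta> k * e k) (P (k - 1)))"
    by (simp add: sum_distrib_left mult_smult_right rec smult_add_right sum.distrib mult.commute)
  also have "(\<Sum>k\<le>m. smult (e k) (P (Suc k))) =
      (\<Sum>k\<le>Suc m. smult (case k of 0 \<Rightarrow> 0 | Suc i \<Rightarrow> e i) (P k))"
    by (subst sum.atMost_Suc_shift) simp
  also have "(\<Sum>k\<le>m. smult (\<alpha> k * e k) (P k)) = (\<Sum>k\<le>Suc m. smult (\<alpha> k * e k) (P k))"
    by (simp add: e)
  \<comment> \<open>Two zero terms are added so that the shifted sum ends at \<open>Suc m\<close>.
    The term k = 0, where \<open>k - 1\<close> is truncated, drops out by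
    \<open>\<beta> 0 = 0\<close>.\<close>
  also have "(\<Sum>k\<le>m. smult (\<beta> k * e k) (P (k - 1))) = (\<Sum>k\<le>Suc (Suc m). smult (\<beta> k * e k) (P (k - 1)))"
    by (simp add: e)
  also have "\<dots> = (\<Sum>k\<le>Suc m. smult (\<beta> (Suc k) * e (Suc k)) (P k))"
    by (subst sum.atMost_Suc_shift) (simp add: \<open>\<beta> 0 = 0\<close>)
  finally show ?thesis
    by (simp only: smult_add_left sum.distrib)
qed

text \<open>At n = 0 the truncated \<open>n - 1\<close> yields Q_0 in place of Q_(-1), harmlessly,
  since 1 - q^0 = 0.\<close>

lemma (in -) alsalam_chihara_nat_recurrence:
  "[:0, 2:] * alsalam_chihara a b q (int n) =
     alsalam_chihara a b q (int (Suc n))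
     + smult ((a + b) * q ^ n) (alsalam_chihara a b q (int n))
     + smult ((1 - q ^ n) * (1 - a * b * q ^ (n - 1))) (alsalam_chihara a b q (int (n - 1)))"
proof (cases n)
  case 0
  then show ?thesis
    using alsalam_chihara_recurrence[of 0 a b q] by (simp add: alsalam_chihara_minus_1)
next
  case (Suc m)
  then show ?thesis
    using alsalam_chihara_recurrence[of "int n" a b q] by (simp add: power_int_def nat_add_distrib add_ac)
qed

text \<open>The summand with factor 0 is kept to match the shape in
  \<open>three_term_recurrence_sum\<close>.\<close>

lemma (in -) q_hermite_recurrence:
  "[:0, 2:] * alsalam_chihara 0 0 q (int n) =
     alsalam_chihara 0 0 q (int (Suc n)) + smult 0 (alsalam_chihara 0 0 q (int n))
     + smult (1 - q ^ n) (alsalam_chihara 0 0 q (int (n - 1)))"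
  using alsalam_chihara_nat_recurrence[of 0 0 q n] by simp


section \<open>From \<open>q\<close>-Hermite to Al-Salam--Chihara polynomials\<close>

definition connection :: "'a \<Rightarrow> 'a \<Rightarrow> nat \<Rightarrow> nat \<Rightarrow> 'a" where
  "connection a b m k = gauss_binomial q m k * rogers_szego a b (m - k)"

text \<open>This compares the coefficients of Q_k in H_(m+2) = 2x H_(m+1) - (1 - q^(m+1)) H_m. The
  contributions of \<open>connection\<close> at (m+1, k+1) and at (m, k) contain the same product
  \<open>g * r\<close>, so the q-Pascal rule and the Rogers-Szego recurrence suffice.\<close>

lemma connection_recurrence:
  "connection a b (Suc (Suc m)) k =
     (case k of 0 \<Rightarrow> 0 | Suc i \<Rightarrow> connection a b (Suc m) i) + (a + b) * q ^ k * connection a b (Suc m) k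
     + (1 - q ^ Suc k) * (1 - a * b * q ^ k) * connection a b (Suc m) (Suc k)
     - (1 - q ^ Suc m) * connection a b m k"
proof -
  have pascal: "gauss_binomial q (Suc (Suc m)) k =
      (case k of 0 \<Rightarrow> 0 | Suc i \<Rightarrow> gauss_binomial q (Suc m) i) + q ^ k * gauss_binomial q (Suc m) k"
    by (cases k) (simp_all add: gauss_binomial_0 gauss_binomial_Suc_Suc)
  have shift: "(case k of 0 \<Rightarrow> 0 | Suc i \<Rightarrow> connection a b (Suc m) i) =
      (case k of 0 \<Rightarrow> 0 | Suc i \<Rightarrow> gauss_binomial q (Suc m) i) * rogers_szego a b (Suc (Suc m) - k)"
    by (cases k) (simp_all add: connection_def)
  define g where "g = gauss_binomial q (Suc m) k"
  \<comment> \<open>The first factor is 0 at k = m + 1, which makes the truncated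
    \<open>m - k\<close> harmless.\<close>
  define r where "r = (1 - q ^ (Suc m - k)) * rogers_szego a b (m - k)"
  have up: "(1 - q ^ Suc k) * connection a b (Suc m) (Suc k) = g * r"
    unfolding connection_def mult.assoc[symmetric] gauss_binomial_Suc_right
    by (simp add: g_def r_def mult_ac)
  have down: "(1 - q ^ Suc m) * connection a b m k = g * r"
  proof (cases "k \<le> m")
    case True
    then have "(1 - q ^ Suc m) * gauss_binomial q m k = (1 - q ^ Suc (m - k)) * g"
      using gauss_binomial_absorb_comp[of "m - k" k] by (simp add: g_def)
    then show ?thesis
      unfolding connection_def mult.assoc[symmetric] using True by (simp add: r_def Suc_diff_le mult_ac)
  qed (simp add: connection_def r_def gauss_binomial_eq_0)
  \<comment> \<open>The factor \<open>g\<close> stays because for k > m + 1 the identity is true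
    only through \<open>g = 0\<close>.\<close>
  have rs: "g * rogers_szego a b (Suc (Suc m) - k) =
      g * ((a + b) * rogers_szego a b (Suc m - k) - a * b * r)"
  proof -
    consider "k \<le> m" | "k = Suc m" | "k > Suc m" by linarith
    then show ?thesis
    proof cases
      case 1
      then show ?thesis
        by (simp add: r_def Suc_diff_le rogers_szego_recurrence)
    qed (simp_all add: r_def g_def rogers_szego_0 rogers_szego_1 gauss_binomial_eq_0)
  qed
  have "connection a b (Suc (Suc m)) k = (case k of 0 \<Rightarrow> 0 | Suc i \<Rightarrow> connection a b (Suc m) i)
      + q ^ k * (g * rogers_szego a b (Suc (Suc m) - k))"
    unfolding shift by (simp add: connection_def pascal g_def algebra_simps)
  also have "\<dots> = (case k of 0 \<Rightarrow> 0 | Suc i \<Rightarrow> connection a b (Suc m) i)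
      + (a + b) * q ^ k * connection a b (Suc m) k + (1 - a * b * q ^ k) * (g * r) - g * r"
    unfolding rs by (simp add: connection_def g_def algebra_simps)
  also have "(1 - a * b * q ^ k) * (g * r) =
      (1 - q ^ Suc k) * (1 - a * b * q ^ k) * connection a b (Suc m) (Suc k)"
    by (simp only: up[symmetric] mult_ac)
  finally show ?thesis
    by (simp only: down)
qed

lemma q_hermite_expansion:
  "alsalam_chihara 0 0 q (int m) = (\<Sum>k\<le>m. smult (connection a b m k) (alsalam_chihara a b q (int k)))"
proof (induction m rule: induct_nat_012)
  case 0
  then show ?case
    by (simp add: alsalam_chihara_0 connection_def gauss_binomial_0 rogers_szego_0)
next
  case 1
  show ?case
    using alsalam_chihara_nat_recurrence[of a b q 0] q_hermite_recurrence[of q 0]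
    by (simp add: alsalam_chihara_0 connection_def gauss_binomial_0 gauss_binomial_self
        rogers_szego_0 rogers_szego_1 add.commute)
next
  case (ge2 m)
  let ?Q = "\<lambda>k. alsalam_chihara a b q (int k)"
  have "alsalam_chihara 0 0 q (int (Suc (Suc m))) =
      [:0, 2:] * alsalam_chihara 0 0 q (int (Suc m)) - smult (1 - q ^ Suc m) (alsalam_chihara 0 0 q (int m))"
    using q_hermite_recurrence[of q "Suc m"] by (simp add: algebra_simps)
  also have "smult (1 - q ^ Suc m) (alsalam_chihara 0 0 q (int m)) =
      (\<Sum>k\<le>m. smult ((1 - q ^ Suc m) * connection a b m k) (?Q k))"
    unfolding ge2 by (simp add: smult_sum_right)
  also have "\<dots> = (\<Sum>k\<le>Suc (Suc m). smult ((1 - q ^ Suc m) * connection a b m k) (?Q k))"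
    by (simp add: connection_def gauss_binomial_eq_0)
  also have "[:0, 2:] * alsalam_chihara 0 0 q (int (Suc m)) =
      (\<Sum>k\<le>Suc (Suc m). smult ((case k of 0 \<Rightarrow> 0 | Suc i \<Rightarrow> connection a b (Suc m) i)
         + (a + b) * q ^ k * connection a b (Suc m) k
         + (1 - q ^ Suc k) * (1 - a * b * q ^ (Suc k - 1)) * connection a b (Suc m) (Suc k)) (?Q k))"
    unfolding ge2
    by (rule three_term_recurrence_sum)
      (simp_all only: alsalam_chihara_nat_recurrence connection_def gauss_binomial_eq_0, simp_all)
  finally show ?case
    by (simp only: connection_recurrence smult_diff_left sum_subtractf diff_Suc_1)
qed


section \<open>From powers to \<open>q\<close>-Hermite polynomials\<close>

text \<open>
  With \<open>U\<^sub>k\<close> the Chebyshev polynomials of the second kind, \<open>ballot N m\<close> is the coefficient of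
  \<open>U\<^sub>N\<^sub>-\<^sub>2\<^sub>m\<close> in \<open>(2x)\<^sup>N\<close>, and \<open>chebyshev_coeff n j\<close> below is the coefficient of \<open>H\<^sub>n\<close> in \<open>U\<^sub>n\<^sub>+\<^sub>2\<^sub>j\<close>.
\<close>

definition (in -) ballot :: "nat \<Rightarrow> int \<Rightarrow> 'a::field" where
  "ballot N m = of_nat (int_binomial N m) - of_nat (int_binomial N (m - 1))"

lemma (in -) int_binomial_Suc: "int_binomial (Suc N) m = int_binomial N m + int_binomial N (m - 1)"
proof (cases "m > 0")
  case True
  then obtain i where "m = int (Suc i)"
    by (metis gr0_conv_Suc zero_less_imp_eq_int)
  then show ?thesis
    by (simp add: int_binomial_def nat_add_distrib)
qed (auto simp: int_binomial_def)

lemma (in -) ballot_Suc: "ballot (Suc N) m = ballot N m + ballot N (m - 1)"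
  by (simp add: ballot_def int_binomial_Suc)

lemma (in -) ballot_neg: "m < 0 \<Longrightarrow> ballot N m = 0"
  by (simp add: ballot_def int_binomial_def)

text \<open>The two binomials agree by symmetry. This value would be the coefficient of U_(-1) =
  0.\<close>

lemma (in -) ballot_middle: "ballot (Suc (2 * M)) (int (Suc M)) = 0"
  using binomial_symmetric[of M "Suc (2 * M)"]
  by (simp add: ballot_def int_binomial_def nat_add_distrib del: binomial_Suc_Suc)

definition chebyshev_coeff :: "nat \<Rightarrow> nat \<Rightarrow> 'a" where
  "chebyshev_coeff n j = (-1) ^ j * q ^ ((j + 1) choose 2) * gauss_binomial q (n + j) j"

lemma chebyshev_coeff_0: "chebyshev_coeff n 0 = 1"
  by (simp add: chebyshev_coeff_def gauss_binomial_0 numeral_2_eq_2)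

lemma (in -) Suc_Suc_choose_2: "Suc (Suc j) choose 2 = (Suc j choose 2) + Suc j"
  by (simp add: numeral_2_eq_2)

text \<open>Coefficients of H_0 in 2x U_(2j+1) = U_(2j+2) + U_(2j); H_0 has no lower
  neighbour.\<close>

lemma chebyshev_coeff_step_0:
  "chebyshev_coeff 0 (Suc j) + chebyshev_coeff 0 j = (1 - q) * chebyshev_coeff (Suc 0) j"
proof -
  have "(1 - q) * gauss_binomial q (Suc j) j = 1 - q ^ Suc j"
    using gauss_binomial_absorb_comp[of 0 j] by (simp add: gauss_binomial_self)
  then have "(1 - q) * chebyshev_coeff (Suc 0) j = (-1) ^ j * q ^ (Suc j choose 2) * (1 - q ^ Suc j)"
    by (simp add: chebyshev_coeff_def)
  then show ?thesis
    by (simp add: chebyshev_coeff_def gauss_binomial_self Suc_Suc_choose_2 power_add algebra_simps)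
qed

text \<open>Coefficients of H_(n+1) in 2x U_(n+2j+2) = U_(n+2j+3) + U_(n+2j+1). By q-Pascal and
  absorption, all terms except the one at (n, j+1) become multiples of \<open>s * g\<close>.\<close>

lemma chebyshev_coeff_step_Suc:
  "chebyshev_coeff (Suc n) (Suc j) + chebyshev_coeff (Suc n) j =
     chebyshev_coeff n (Suc j) + (1 - q ^ Suc (Suc n)) * chebyshev_coeff (Suc (Suc n)) j"
proof -
  define s where "s = (-1) ^ j * q ^ (Suc j choose 2)"
  define g where "g = gauss_binomial q (Suc (n + j)) j"
  have "(1 - q ^ Suc (Suc n)) * chebyshev_coeff (Suc (Suc n)) j = s * ((1 - q ^ (Suc j + Suc n)) * g)"
    using gauss_binomial_absorb_comp[of "Suc n" j]
    by (simp add: chebyshev_coeff_def s_def g_def add_ac mult_ac)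
  moreover have "chebyshev_coeff (Suc n) (Suc j) =
      chebyshev_coeff n (Suc j) - s * q ^ Suc j * (q ^ Suc n * g)"
  proof -
    have "gauss_binomial q (Suc n + Suc j) (Suc j) =
        gauss_binomial q (n + Suc j) (Suc j) + q ^ Suc n * g"
      using gauss_binomial_Suc_Suc'[of "Suc (n + j)" j] by (simp add: g_def Suc_diff_le)
    then show ?thesis
      by (simp add: chebyshev_coeff_def s_def Suc_Suc_choose_2 power_add algebra_simps)
  qed
  moreover have "chebyshev_coeff (Suc n) j = s * g"
    by (simp add: chebyshev_coeff_def s_def g_def)
  ultimately show ?thesis
    by (simp only: power_add) (simp add: algebra_simps)
qed

text \<open>Extension by 0 lets \<open>power_coeff_Suc\<close> hold for every n, without conditions
  on range or parity.\<close>

definition power_coeff :: "nat \<Rightarrow> nat \<Rightarrow> 'a" where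
  "power_coeff N n = (if n \<le> N \<and> n mod 2 = N mod 2
     then \<Sum>j\<le>(N - n) div 2. chebyshev_coeff n j * ballot N (int ((N - n) div 2) - int j) else 0)"

lemma power_coeff_add:
  "power_coeff (n + 2 * M) n = (\<Sum>j\<le>M. chebyshev_coeff n j * ballot (n + 2 * M) (int M - int j))"
  by (simp add: power_coeff_def)

text \<open>Pascal's rule for \<open>ballot\<close> and an index shift pair up neighbouring
  \<open>f\<close>, giving the left-hand sides of the two step lemmas for
  \<open>chebyshev_coeff\<close>.\<close>

lemma sum_ballot_Suc:
  "(\<Sum>j\<le>M. f j * ballot (Suc N) (int M - int j)) =
     f 0 * ballot N (int M) + (\<Sum>j<M. (f (Suc j) + f j) * ballot N (int M - int (Suc j)))"
proof -
  have "(\<Sum>j\<le>M. f j * ballot (Suc N) (int M - int j)) =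
      (\<Sum>j\<le>M. f j * ballot N (int M - int j)) + (\<Sum>j\<le>M. f j * ballot N (int M - int (Suc j)))"
    by (simp add: ballot_Suc algebra_simps sum.distrib)
  also have "(\<Sum>j\<le>M. f j * ballot N (int M - int j)) =
      f 0 * ballot N (int M) + (\<Sum>j<M. f (Suc j) * ballot N (int M - int (Suc j)))"
    by (subst sum.atMost_shift) simp
  \<comment> \<open>The last term has \<open>ballot\<close> at -1, hence is 0.\<close>
  also have "(\<Sum>j\<le>M. f j * ballot N (int M - int (Suc j))) =
      (\<Sum>j<M. f j * ballot N (int M - int (Suc j)))"
    by (simp add: lessThan_Suc_atMost[symmetric] ballot_neg)
  finally show ?thesis
    by (simp only: sum.distrib distrib_right add.assoc)
qed

text \<open>Coefficients of H_n in (2x)^(N+1) = 2x (2x)^N.\<close>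

lemma power_coeff_Suc:
  "power_coeff (Suc N) n =
     (case n of 0 \<Rightarrow> 0 | Suc i \<Rightarrow> power_coeff N i) + (1 - q ^ Suc n) * power_coeff N (Suc n)"
proof (cases "n \<le> Suc N \<and> n mod 2 = Suc N mod 2")
  case False
  then have "\<not> (Suc n \<le> N \<and> Suc n mod 2 = N mod 2)"
      and "\<And>i. n = Suc i \<Longrightarrow> \<not> (i \<le> N \<and> i mod 2 = N mod 2)"
    by presburger+
  with False show ?thesis
    unfolding power_coeff_def by (cases n) (simp_all only: if_False nat.case mult_zero_right add_0_right)
next
  case True
  define M where "M = (Suc N - n) div 2"
  have M: "Suc N = n + 2 * M"
    using True unfolding M_def by presburger
  have up: "power_coeff N (Suc n) = (\<Sum>j<M. chebyshev_coeff (Suc n) j * ballot N (int M - int (Suc j)))"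
  proof (cases M)
    case 0
    then show ?thesis
      using M by (simp add: power_coeff_def)
  next
    case (Suc K)
    then have "N = Suc n + 2 * K"
      using M by simp
    then show ?thesis
      using power_coeff_add[of "Suc n" K] by (simp add: Suc lessThan_Suc_atMost)
  qed
  have eq: "power_coeff (Suc N) n = chebyshev_coeff n 0 * ballot N (int M)
      + (\<Sum>j<M. (chebyshev_coeff n (Suc j) + chebyshev_coeff n j) * ballot N (int M - int (Suc j)))"
    unfolding sum_ballot_Suc[symmetric] using power_coeff_add[of n M] by (simp add: M)
  show ?thesis
  proof (cases n)
    case 0
    \<comment> \<open>For n = 0 the leading term \<open>ballot N (int M)\<close> has no counterpart
      on the right; parity forces N = 2M - 1, where it vanishes.\<close>
    with M obtain K where "M = Suc K" "N = Suc (2 * K)"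
      by (cases M) auto
    then have "ballot N (int M) = (0::'a)"
      by (simp only: ballot_middle)
    then show ?thesis
      using eq up by (simp add: 0 chebyshev_coeff_step_0 sum_distrib_left mult_ac)
  next
    case (Suc i)
    then have "N = i + 2 * M"
      using M by simp
    then have "power_coeff N i = chebyshev_coeff i 0 * ballot N (int M)
        + (\<Sum>j<M. chebyshev_coeff i (Suc j) * ballot N (int M - int (Suc j)))"
      using power_coeff_add[of i M] by (simp add: sum.atMost_shift)
    then show ?thesis
      using eq up
      by (simp add: Suc chebyshev_coeff_step_Suc chebyshev_coeff_0 sum_distrib_left sum.distrib
          distrib_right mult.assoc del: power_Suc)
  qed
qed

lemma power_expansion:
  "[:0, 2:] ^ N = (\<Sum>n\<le>N. smult (power_coeff N n) (alsalam_chihara 0 0 q (int n)))"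
proof (induction N)
  case 0
  then show ?case
    by (simp add: alsalam_chihara_0 power_coeff_def chebyshev_coeff_0 ballot_def int_binomial_def)
next
  case (Suc N)
  have "[:0, 2:] ^ Suc N = [:0, 2:] * (\<Sum>n\<le>N. smult (power_coeff N n) (alsalam_chihara 0 0 q (int n)))"
    by (simp only: power_Suc Suc)
  also have "\<dots> = (\<Sum>n\<le>Suc N. smult ((case n of 0 \<Rightarrow> 0 | Suc i \<Rightarrow> power_coeff N i)
      + 0 * power_coeff N n + (1 - q ^ Suc n) * power_coeff N (Suc n)) (alsalam_chihara 0 0 q (int n)))"
    by (rule three_term_recurrence_sum[OF q_hermite_recurrence]) (simp_all add: power_coeff_def)
  finally show ?case
    by (simp only: power_coeff_Suc mult_zero_left add_0_right)
qed


section \<open>Moments\<close>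

lemma alsalam_chihara_moment:
  assumes L: "Vector_Spaces.linear smult (*) L"
    and L1: "L 1 = 1"
    and L0: "\<And>n. n \<ge> 1 \<Longrightarrow> L (alsalam_chihara a b q n) = 0"
    and two: "(2::'a) \<noteq> 0"
  shows "L ([:0, 1:] ^ N) =
    1 / 2 ^ N * (\<Sum>n | n \<le> N \<and> n mod 2 = N mod 2. power_coeff N n * rogers_szego a b n)"
proof -
  interpret L: Vector_Spaces.linear smult "(*)" L
    by (fact L)
  have "L (alsalam_chihara 0 0 q (int m)) = rogers_szego a b m" for m
  proof -
    have "L (alsalam_chihara 0 0 q (int m)) =
        (\<Sum>k\<le>m. connection a b m k * L (alsalam_chihara a b q (int k)))"
      unfolding q_hermite_expansion[of m a b] by (simp add: L.sum L.scale)
    also have "\<dots> = (\<Sum>k\<le>m. if k = 0 then connection a b m 0 else 0)"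
      by (intro sum.cong) (auto simp: L0 L1 alsalam_chihara_0)
    finally show ?thesis
      by (simp add: connection_def gauss_binomial_0)
  qed
  then have "L ([:0, 2:] ^ N) = (\<Sum>n\<le>N. power_coeff N n * rogers_szego a b n)"
    by (simp add: power_expansion L.sum L.scale)
  also have "\<dots> = (\<Sum>n | n \<le> N \<and> n mod 2 = N mod 2. power_coeff N n * rogers_szego a b n)"
    by (rule sum.mono_neutral_right) (auto simp: power_coeff_def)
  also have "[:0, 2:] = smult 2 ([:0, 1:] :: 'a poly)"
    by simp
  finally show ?thesis
    using two by (simp only: smult_power L.scale) (simp add: field_simps)
qed

end

section \<open>Specialisation to rational functions in a, b, q\<close>

lemma to_fract_power: "to_fract (x ^ n) = to_fract x ^ n"
  by (induction n) simp_all

text \<open>The n-th power of the variable has degree n > 0, so it differs from 1, also after the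
  injective embedding into the fraction field.\<close>

lemma non_root_of_unity_indet_q: "non_root_of_unity indet_q"
proof
  fix n :: nat
  assume "n > 0"
  then have "([:0, 1:] :: rat poly poly poly) ^ n \<noteq> 1"
    by (metis degree_1 degree_linear_power less_irrefl)
  then show "indet_q ^ n \<noteq> 1"
    unfolding indet_q_def to_fract_power[symmetric] by (simp flip: to_fract_1)
qed

lemma two_neq_0: "(2 :: ratfun_abq) \<noteq> 0"
proof -
  have "(2 :: ratfun_abq) = to_fract 2"
    by (simp only: one_add_one[symmetric] to_fract_add to_fract_1)
  then show ?thesis
    by simp
qed

theorem theorem6p1:
  fixes a b q :: ratfun_abq
    and Q :: "int \<Rightarrow> ratfun_abq poly"
    and L :: "ratfun_abq poly \<Rightarrow> ratfun_abq"
    and \<mu> :: "nat \<Rightarrow> ratfun_abq"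
    and N :: nat
  assumes "a = indet_a" and "b = indet_b" and "q = indet_q"
    and "Q = alsalam_chihara a b q"
    and "Vector_Spaces.linear smult (*) L"
    and "L 1 = 1"
    and "\<And>n. n \<ge> 1 \<Longrightarrow> L (Q n) = 0"
    and "\<And>m. \<mu> m = L ([:0, 1:] ^ m)"
  shows "\<mu> N =
    1 / 2 ^ N *
    (\<Sum>n | n \<le> N \<and> n mod 2 = N mod 2.
       (\<Sum>j = 0..(N - n) div 2.
          (-1) ^ j * q ^ ((j + 1) choose 2) * gauss_binomial q (n + j) j *
          (of_nat (int_binomial N (int ((N - n) div 2) - int j))
           - of_nat (int_binomial N (int ((N - n) div 2) - int j - 1)))) *
       (\<Sum>k = 0..n. gauss_binomial q n k * a ^ k * b ^ (n - k)))"
proof -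
  interpret non_root_of_unity q
    unfolding \<open>q = indet_q\<close> by (rule non_root_of_unity_indet_q)
  have "\<mu> N = 1 / 2 ^ N *
      (\<Sum>n | n \<le> N \<and> n mod 2 = N mod 2. power_coeff N n * rogers_szego a b n)"
    unfolding assms(8)
    by (rule alsalam_chihara_moment[OF assms(5,6) assms(7)[unfolded assms(4)] two_neq_0])
  also have "(\<Sum>n | n \<le> N \<and> n mod 2 = N mod 2. power_coeff N n * rogers_szego a b n) =
      (\<Sum>n | n \<le> N \<and> n mod 2 = N mod 2.
         (\<Sum>j = 0..(N - n) div 2. chebyshev_coeff n j * ballot N (int ((N - n) div 2) - int j)) *
         rogers_szego a b n)"
    by (rule sum.cong) (simp_all only: power_coeff_def mem_Collect_eq simp_thms if_True atMost_atLeast0)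
  finally show ?thesis
    by (simp only: chebyshev_coeff_def ballot_def rogers_szego_def atMost_atLeast0)
qed

end
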